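(* Let $\{P_\theta\}_{\theta\in\Theta}$ be a regular one-parameter exponential family with log-partition function $b$, and let $V_{\min}<V_{\max}$ be constants in the image of $b'$. For each $n\ge2$ let $\boldsymbol\mu^\star=\boldsymbol\mu^{\star,(n)}=(\mu_1^\star,\dots,\mu_n^\star)$ be an arbitrary vector with $V_{\min}\le\mu_i^\star\le V_{\max}$ for all $i$; let $X_1,\dots,X_n$ be independent with $X_i\sim P_{\theta_i^\star}$, $\theta_i^\star=(b')^{-1}(\mu_i^\star)$; let $\pi^\star$ be a permutation of $\{1,\dots,n\}$ with $\mu^\star_{\pi^\star(1)}\ge\cdots\ge\mu^\star_{\pi^\star(n)}$; and let $\widehat{\boldsymbol\mu}$ be the minimizer of $\sum_{i=1}^n(X_i-\mu_i)^2$ subject to $\mu_{\pi^\star(1)}\ge\cdots\ge\mu_{\pi^\star(n)}$. Then $$\limsup_{n\to\infty}\frac1n\,\mathbb{E}\|\widehat{\boldsymbol\mu}-\boldsymbol\mu^\star\|^2=0,$$ where $\|\cdot\|$ is the Euclidean norm.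
   Context: Regular one-parameter exponential family: there are a base measure $\rho$ on $\mathbb{R}$, a carrier function $c\ge 0$, an open interval $\Theta\subseteq\mathbb{R}$, and a log-partition function $b:\Theta\to\mathbb{R}$ such that for each $\theta\in\Theta$, $P_\theta$ has density $p_\theta(x)=e^{\theta x-b(\theta)}c(x)$ with respect to $\rho$; $b$ is twice differentiable with $b''(\theta)>0$ on $\Theta$. One has $\mathbb{E}_\theta[X]=b'(\theta)$ and $\mathrm{Var}_\theta(X)=b''(\theta)\in(0,\infty)$. *)

theory Defs
  imports "HOL-Probability.Probability" "HOL-Combinatorics.Permutations"
begin

definition expfam :: "real measure \<Rightarrow> (real \<Rightarrow> real) \<Rightarrow> (real \<Rightarrow> real) \<Rightarrow> real \<Rightarrow> real measure" where
  "expfam \<rho> c b \<theta> = density \<rho> (\<lambda>x. ennreal (exp (\<theta> * x - b \<theta>) * c x))"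

text \<open>The function \<open>b\<close> matters only on the open set \<open>\<Theta>\<close>, so \<open>deriv b\<close> and \<open>deriv (deriv b)\<close>
  are the usual first and second derivatives there. That each member has mean \<open>deriv b \<theta>\<close> and
  variance \<open>deriv (deriv b) \<theta>\<close> is a consequence and hence not an assumption.\<close>

locale regular_exponential_family =
  fixes \<rho> :: "real measure" and c :: "real \<Rightarrow> real" and \<Theta> :: "real set" and b :: "real \<Rightarrow> real"
  assumes sets_base: "sets \<rho> = sets borel"
    and carrier_measurable: "c \<in> borel_measurable borel"
    and carrier_nonneg: "\<And>x. 0 \<le> c x"
    and open_param: "open \<Theta>"
    and interval_param: "is_interval \<Theta>"
    and prob_space_expfam: "\<And>\<theta>. \<theta> \<in> \<Theta> \<Longrightarrow> prob_space (expfam \<rho> c b \<theta>)"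
    and b_differentiable: "\<And>\<theta>. \<theta> \<in> \<Theta> \<Longrightarrow> b differentiable at \<theta>"
    and deriv_b_differentiable: "\<And>\<theta>. \<theta> \<in> \<Theta> \<Longrightarrow> deriv b differentiable at \<theta>"
    and deriv2_b_pos: "\<And>\<theta>. \<theta> \<in> \<Theta> \<Longrightarrow> 0 < deriv (deriv b) \<theta>"

text \<open>A vector in \<open>n\<close>-dimensional space is a function of which only the values on \<open>{1..n}\<close> matter.\<close>

definition decreasing_along :: "nat \<Rightarrow> (nat \<Rightarrow> nat) \<Rightarrow> (nat \<Rightarrow> real) set" where
  "decreasing_along n \<pi> = {m. \<forall>i\<in>{1..n}. \<forall>j\<in>{1..n}. i \<le> j \<longrightarrow> m (\<pi> j) \<le> m (\<pi> i)}"

text \<open>The choice made by \<^const>\<open>arg_min_on\<close> affects only coordinates outside \<open>{1..n}\<close>: when \<open>\<pi>\<close>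
  permutes \<open>{1..n}\<close>, the minimizer is unique on \<open>{1..n}\<close>, being the projection onto a closed
  convex cone.\<close>

definition isotonic_lse :: "nat \<Rightarrow> (nat \<Rightarrow> nat) \<Rightarrow> (nat \<Rightarrow> real) \<Rightarrow> nat \<Rightarrow> real" where
  "isotonic_lse n \<pi> x = arg_min_on (\<lambda>m. \<Sum>i=1..n. (x i - m i)\<^sup>2) (decreasing_along n \<pi>)"

end

theory Submission
  imports Defs "HOL-Real_Asymp.Real_Asymp"
begin

text \<open>
  Write \<open>\<epsilon> = X - \<mu>\<close>. Comparing the least squares estimate \<open>m\<close> with the feasible vector \<open>\<mu>\<close> bounds its
  squared error by \<open>2 \<langle>\<epsilon>, m - \<mu>\<rangle>\<close>. Both vectors are monotone along \<open>\<pi>\<close>, the estimate takes values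
  between \<open>- max\<^sub>i \<bar>X\<^sub>i\<bar>\<close> and \<open>max\<^sub>i \<bar>X\<^sub>i\<bar>\<close>, so summation by parts bounds the inner product by a multiple of
  \<open>(max\<^sub>i \<bar>X\<^sub>i\<bar> + V) max\<^sub>k \<bar>S\<^sub>k\<bar>\<close>, where \<open>S\<^sub>k\<close> are the partial sums of \<open>\<epsilon>\<close> along \<open>\<pi>\<close> and \<open>V\<close> bounds \<open>\<bar>\<mu>\<^sub>i\<bar>\<close>. The sixth moments of \<open>P\<^sub>\<theta>\<close> are
  bounded uniformly over a compact range of \<open>\<theta>\<close>, hence \<open>E max\<^sub>i X\<^sub>i\<^sup>2 = O(n\<^bsup>1/3\<^esup>)\<close>. Controlling \<open>S\<^sub>k\<close> only at
  multiples of a block length \<open>L \<approx> \<surd>n\<close>, and inside a block by Cauchy-Schwarz, gives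
  \<open>E max\<^sub>k S\<^sub>k\<^sup>2 = O(n\<^bsup>3/2\<^esup>)\<close> without a maximal inequality. The risk is therefore \<open>O(n\<^bsup>11/12\<^esup>) = o(n)\<close>.
\<close>

section \<open>Exponential moments, absolute moments and the mean of the family\<close>

text \<open>Raise \<open>y \<le> exp y\<close> with \<open>y = \<bar>x\<bar> * \<delta> / p\<close>
  to the power \<open>p\<close>. This trades polynomial moments for the moment generating function
  at \<open>\<delta>\<close> and \<open>- \<delta>\<close>.\<close>

lemma abs_power_le_exp:
  fixes x \<delta> :: real
  assumes "0 < \<delta>"
  shows "\<bar>x\<bar> ^ p \<le> (real p / \<delta>) ^ p * (exp (\<delta> * x) + exp (- \<delta> * x))"
proof (cases "p = 0")
  case True
  moreover have "1 \<le> exp (\<delta> * x) + exp (- \<delta> * x)"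
    using exp_ge_add_one_self[of "\<delta> * x"] exp_ge_add_one_self[of "- \<delta> * x"] exp_gt_zero[of "\<delta> * x"]
      exp_gt_zero[of "- \<delta> * x"] by linarith
  ultimately show ?thesis by simp
next
  case False
  define y where "y = \<bar>x\<bar> * \<delta> / real p"
  have "y \<le> exp y" using exp_ge_add_one_self[of y] by linarith
  moreover have "0 \<le> y" using assms by (simp add: y_def)
  ultimately have "y ^ p \<le> exp y ^ p" by (rule power_mono)
  also have "\<dots> = exp (\<delta> * \<bar>x\<bar>)"
    using False by (simp add: y_def mult.commute flip: exp_of_nat_mult)
  also have "\<dots> \<le> exp (\<delta> * x) + exp (- \<delta> * x)"
    by (cases "x \<ge> 0") auto
  finally have *: "y ^ p \<le> exp (\<delta> * x) + exp (- \<delta> * x)" .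
  have "\<bar>x\<bar> ^ p = (real p / \<delta>) ^ p * y ^ p"
    using False assms by (simp add: y_def flip: power_mult_distrib)
  also have "\<dots> \<le> (real p / \<delta>) ^ p * (exp (\<delta> * x) + exp (- \<delta> * x))"
    using * assms by (intro mult_left_mono) auto
  finally show ?thesis .
qed

context regular_exponential_family
begin

lemma sets_expfam: "sets (expfam \<rho> c b \<theta>) = sets borel"
  by (simp add: expfam_def sets_base)

lemma measurable_expfam: "borel_measurable (expfam \<rho> c b \<theta>) = borel_measurable borel"
  by (rule measurable_cong_sets) (simp_all add: sets_expfam)

text \<open>Multiplying the density at \<open>\<theta>\<close> by \<open>exp (h * x)\<close> gives a
  constant multiple of the density at \<open>\<theta> + h\<close>, whose total mass is one; the
  constant is the integral.\<close>

lemma mgf_expfam: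
  assumes "\<theta> + h \<in> \<Theta>"
  shows "has_bochner_integral (expfam \<rho> c b \<theta>) (\<lambda>x. exp (h * x)) (exp (b (\<theta> + h) - b \<theta>))"
proof (rule has_bochner_integral_nn_integral)
  have [measurable]: "c \<in> borel_measurable \<rho>"
    using carrier_measurable sets_base measurable_cong_sets by blast
  have [measurable]: "(\<lambda>x. x) \<in> borel_measurable \<rho>"
    using sets_base by simp
  have "(\<integral>\<^sup>+x. ennreal (exp (h * x)) \<partial>expfam \<rho> c b \<theta>) =
      (\<integral>\<^sup>+x. ennreal (exp (\<theta> * x - b \<theta>) * c x) * ennreal (exp (h * x)) \<partial>\<rho>)"
    unfolding expfam_def by (subst nn_integral_density) auto
  also have "\<dots> = (\<integral>\<^sup>+x. ennreal (exp (b (\<theta> + h) - b \<theta>)) *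
      ennreal (exp ((\<theta> + h) * x - b (\<theta> + h)) * c x) \<partial>\<rho>)"
  proof (rule nn_integral_cong)
    fix x
    have "exp (\<theta> * x - b \<theta>) * exp (h * x) =
        exp (b (\<theta> + h) - b \<theta>) * exp ((\<theta> + h) * x - b (\<theta> + h))"
      by (simp add: algebra_simps flip: exp_add)
    then have "exp (\<theta> * x - b \<theta>) * exp (h * x) * c x =
        exp (b (\<theta> + h) - b \<theta>) * exp ((\<theta> + h) * x - b (\<theta> + h)) * c x"
      by (rule arg_cong)
    then have "exp (\<theta> * x - b \<theta>) * c x * exp (h * x) =
        exp (b (\<theta> + h) - b \<theta>) * (exp ((\<theta> + h) * x - b (\<theta> + h)) * c x)"
      by (simp only: ac_simps)
    then show "ennreal (exp (\<theta> * x - b \<theta>) * c x) * ennreal (exp (h * x)) =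
        ennreal (exp (b (\<theta> + h) - b \<theta>)) * ennreal (exp ((\<theta> + h) * x - b (\<theta> + h)) * c x)"
      using carrier_nonneg[of x] by (simp flip: ennreal_mult)
  qed
  also have "\<dots> = ennreal (exp (b (\<theta> + h) - b \<theta>)) *
      (\<integral>\<^sup>+x. ennreal (exp ((\<theta> + h) * x - b (\<theta> + h)) * c x) \<partial>\<rho>)"
    by (rule nn_integral_cmult) simp
  also have "(\<integral>\<^sup>+x. ennreal (exp ((\<theta> + h) * x - b (\<theta> + h)) * c x) \<partial>\<rho>) =
      emeasure (expfam \<rho> c b (\<theta> + h)) (space \<rho>)"
    unfolding expfam_def by (subst emeasure_density)
      (auto intro!: nn_integral_cong)
  also have "\<dots> = 1"
    using prob_space.emeasure_space_1[OF prob_space_expfam[OF assms]] by (simp add: expfam_def)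
  finally show "(\<integral>\<^sup>+x. ennreal (exp (h * x)) \<partial>expfam \<rho> c b \<theta>) =
      ennreal (exp (b (\<theta> + h) - b \<theta>))"
    by simp
qed (simp_all add: measurable_expfam)

lemma abs_moment_expfam:
  assumes "0 < \<delta>" "\<theta> + \<delta> \<in> \<Theta>" "\<theta> - \<delta> \<in> \<Theta>"
  shows "integrable (expfam \<rho> c b \<theta>) (\<lambda>x. \<bar>x\<bar> ^ p)"
    and "(\<integral>x. \<bar>x\<bar> ^ p \<partial>expfam \<rho> c b \<theta>) \<le>
      (real p / \<delta>) ^ p * (exp (b (\<theta> + \<delta>) - b \<theta>) + exp (b (\<theta> - \<delta>) - b \<theta>))"
proof -
  have hbi: "has_bochner_integral (expfam \<rho> c b \<theta>)
      (\<lambda>x. (real p / \<delta>) ^ p * (exp (\<delta> * x) + exp (- \<delta> * x)))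
      ((real p / \<delta>) ^ p * (exp (b (\<theta> + \<delta>) - b \<theta>) + exp (b (\<theta> + - \<delta>) - b \<theta>)))"
    using assms by (intro has_bochner_integral_mult_right has_bochner_integral_add mgf_expfam) auto
  show int: "integrable (expfam \<rho> c b \<theta>) (\<lambda>x. \<bar>x\<bar> ^ p)"
  proof (rule Bochner_Integration.integrable_bound)
    show "AE x in expfam \<rho> c b \<theta>. norm (\<bar>x\<bar> ^ p) \<le>
        norm ((real p / \<delta>) ^ p * (exp (\<delta> * x) + exp (- \<delta> * x)))"
      using abs_power_le_exp[OF assms(1), of _ p] by (auto intro: order.trans[OF _ abs_ge_self])
  qed (use hbi in \<open>auto simp: has_bochner_integral_iff measurable_expfam\<close>)
  have "(\<integral>x. \<bar>x\<bar> ^ p \<partial>expfam \<rho> c b \<theta>) \<le>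
      (\<integral>x. (real p / \<delta>) ^ p * (exp (\<delta> * x) + exp (- \<delta> * x)) \<partial>expfam \<rho> c b \<theta>)"
    using hbi int abs_power_le_exp[OF assms(1), of _ p]
    by (intro integral_mono) (auto simp: has_bochner_integral_iff)
  then show "(\<integral>x. \<bar>x\<bar> ^ p \<partial>expfam \<rho> c b \<theta>) \<le>
      (real p / \<delta>) ^ p * (exp (b (\<theta> + \<delta>) - b \<theta>) + exp (b (\<theta> - \<delta>) - b \<theta>))"
    by (simp only: has_bochner_integral_integral_eq[OF hbi] add_uminus_conv_diff)
qed

text \<open>Since \<open>1 + h x \<le> exp (h x)\<close>, the function \<open>h \<mapsto> exp (b (\<theta> + h) - b \<theta>) - 1 - h E X\<close> is
  nonnegative and vanishes at \<open>0\<close>, so its derivative \<open>b' \<theta> - E X\<close> there is zero.\<close>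

lemma mean_expfam:
  assumes "\<theta> \<in> \<Theta>"
  shows "has_bochner_integral (expfam \<rho> c b \<theta>) (\<lambda>x. x) (deriv b \<theta>)"
proof -
  obtain \<delta> where \<delta>: "0 < \<delta>" "\<And>y. \<bar>y - \<theta>\<bar> \<le> \<delta> \<Longrightarrow> y \<in> \<Theta>"
    using open_param assms by (auto simp: open_contains_cball subset_iff dist_real_def
        abs_minus_commute)
  interpret P: prob_space "expfam \<rho> c b \<theta>"
    using assms by (rule prob_space_expfam)
  have int: "integrable (expfam \<rho> c b \<theta>) (\<lambda>x. x)"
    using abs_moment_expfam(1)[of \<delta> \<theta> 1] \<delta>
    by (subst integrable_norm_iff[symmetric]) (auto simp: measurable_expfam real_norm_def[abs_def])
  let ?m = "\<integral>x. x \<partial>expfam \<rho> c b \<theta>"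
  have "((\<lambda>h. exp (b (\<theta> + h) - b \<theta>) - 1 - h * ?m) has_real_derivative deriv b \<theta> - ?m) (at 0)"
  proof -
    \<comment> \<open>The point is kept as \<open>\<theta> + 0\<close>, the value at zero of the
      inner map in the chain rule.\<close>
    have "(b has_real_derivative deriv b \<theta>) (at (\<theta> + 0))"
      using b_differentiable[OF assms] by (simp add: DERIV_deriv_iff_real_differentiable)
    then show ?thesis
      by (auto intro!: derivative_eq_intros DERIV_chain2[where f = b] simp: DERIV_shift)
  qed
  moreover have "exp (b (\<theta> + 0) - b \<theta>) - 1 - 0 * ?m \<le> exp (b (\<theta> + h) - b \<theta>) - 1 - h * ?m"
    if "\<bar>0 - h\<bar> < \<delta>" for h
  proof -
    have "\<theta> + h \<in> \<Theta>"
      using that by (intro \<delta>) auto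
    note mgf = mgf_expfam[OF this]
    have "(\<integral>x. 1 + h * x \<partial>expfam \<rho> c b \<theta>) \<le> (\<integral>x. exp (h * x) \<partial>expfam \<rho> c b \<theta>)"
      using mgf int by (intro integral_mono) (auto simp: has_bochner_integral_iff)
    then show ?thesis
      using mgf int P.prob_space by (simp add: has_bochner_integral_iff)
  qed
  ultimately have "deriv b \<theta> - ?m = 0"
    using \<delta>(1) by (intro DERIV_local_min[of _ _ 0 \<delta>]) auto
  then show ?thesis
    using int by (simp add: has_bochner_integral_iff)
qed

section \<open>Inverting the mean map, and uniform moments over compact parameter ranges\<close>

lemma atLeastAtMost_subset_param:
  assumes "lo \<in> \<Theta>" "hi \<in> \<Theta>"
  shows "{lo..hi} \<subseteq> \<Theta>"
proof
  fix x assume "x \<in> {lo..hi}"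
  then show "x \<in> \<Theta>"
    using mem_is_interval_1_I[OF interval_param assms, of x] by simp
qed

lemma strict_mono_on_deriv_b: "strict_mono_on \<Theta> (deriv b)"
proof (rule strict_mono_onI)
  fix r s assume rs: "r \<in> \<Theta>" "s \<in> \<Theta>" "r < s"
  show "deriv b r < deriv b s"
  proof (rule DERIV_pos_imp_increasing[OF rs(3)])
    fix x assume "r \<le> x" "x \<le> s"
    then have "x \<in> \<Theta>"
      using atLeastAtMost_subset_param[OF rs(1,2)] by auto
    then show "\<exists>y. (deriv b has_real_derivative y) (at x) \<and> 0 < y"
      using deriv_b_differentiable deriv2_b_pos DERIV_deriv_iff_real_differentiable by blast
  qed
qed

text \<open>The intermediate value theorem supplies a preimage in \<open>{lo..hi}\<close>, and
  injectivity of \<open>deriv b\<close> identifies it with the inverse. This confines all parameters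
  of the data to one compact interval.\<close>

lemma the_inv_into_deriv_b:
  assumes "lo \<in> \<Theta>" "hi \<in> \<Theta>" "deriv b lo \<le> m" "m \<le> deriv b hi"
  shows "the_inv_into \<Theta> (deriv b) m \<in> {lo..hi}" "the_inv_into \<Theta> (deriv b) m \<in> \<Theta>"
    and "deriv b (the_inv_into \<Theta> (deriv b) m) = m"
proof -
  have le: "lo \<le> hi"
    using strict_mono_onD[OF strict_mono_on_deriv_b, of hi lo] assms by force
  have sub: "{lo..hi} \<subseteq> \<Theta>"
    using assms(1,2) by (rule atLeastAtMost_subset_param)
  have "continuous_on {lo..hi} (deriv b)"
    using sub deriv_b_differentiable
    by (intro continuous_at_imp_continuous_on) (auto intro!: differentiable_imp_continuous_within)
  then obtain \<theta> where \<theta>: "\<theta> \<in> {lo..hi}" "deriv b \<theta> = m"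
    using IVT'[of "deriv b" lo m hi] assms le by auto
  moreover have "the_inv_into \<Theta> (deriv b) m = \<theta>"
    using \<theta> sub strict_mono_on_imp_inj_on[OF strict_mono_on_deriv_b]
    by (auto intro!: the_inv_into_f_eq)
  ultimately show "the_inv_into \<Theta> (deriv b) m \<in> {lo..hi}" "the_inv_into \<Theta> (deriv b) m \<in> \<Theta>"
    and "deriv b (the_inv_into \<Theta> (deriv b) m) = m"
    using sub by auto
qed

text \<open>Openness leaves room to shift every point of \<open>{lo..hi}\<close> by a common
  \<open>\<delta>\<close> in both directions. On the widened compact interval the continuous
  \<open>b\<close> is bounded, which controls the constants in
  \<open>abs_moment_expfam\<close>.\<close>

lemma uniform_abs_moment_bound:
  assumes "lo \<in> \<Theta>" "hi \<in> \<Theta>"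
  shows "\<exists>K\<ge>0. \<forall>\<theta>\<in>{lo..hi}. integrable (expfam \<rho> c b \<theta>) (\<lambda>x. \<bar>x\<bar> ^ p) \<and>
    (\<integral>x. \<bar>x\<bar> ^ p \<partial>expfam \<rho> c b \<theta>) \<le> K"
proof -
  obtain d e where d: "0 < d" "\<And>y. \<bar>y - lo\<bar> \<le> d \<Longrightarrow> y \<in> \<Theta>"
    and e: "0 < e" "\<And>y. \<bar>y - hi\<bar> \<le> e \<Longrightarrow> y \<in> \<Theta>"
    using open_param assms unfolding open_contains_cball subset_iff mem_cball dist_real_def
    by (metis abs_minus_commute)
  define \<delta> where "\<delta> = min d e"
  have \<delta>: "0 < \<delta>" "lo - \<delta> \<in> \<Theta>" "hi + \<delta> \<in> \<Theta>"
    using d e by (auto simp: \<delta>_def)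
  have sub: "{lo - \<delta>..hi + \<delta>} \<subseteq> \<Theta>"
    using \<delta>(2,3) by (rule atLeastAtMost_subset_param)
  have "continuous_on {lo - \<delta>..hi + \<delta>} b"
    using sub b_differentiable
    by (intro continuous_at_imp_continuous_on) (auto intro!: differentiable_imp_continuous_within)
  then have "bounded (b ` {lo - \<delta>..hi + \<delta>})"
    by (intro compact_imp_bounded compact_continuous_image) auto
  then obtain \<beta> where \<beta>: "\<And>\<theta>. \<theta> \<in> {lo - \<delta>..hi + \<delta>} \<Longrightarrow> \<bar>b \<theta>\<bar> \<le> \<beta>"
    unfolding bounded_iff ball_simps real_norm_def by blast
  define K where "K = (real p / \<delta>) ^ p * (exp (2 * \<beta>) + exp (2 * \<beta>))"
  have "integrable (expfam \<rho> c b \<theta>) (\<lambda>x. \<bar>x\<bar> ^ p) \<and>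
      (\<integral>x. \<bar>x\<bar> ^ p \<partial>expfam \<rho> c b \<theta>) \<le> K" if \<theta>: "\<theta> \<in> {lo..hi}" for \<theta>
  proof -
    have *: "\<theta> + \<delta> \<in> \<Theta>" "\<theta> - \<delta> \<in> \<Theta>"
      using sub \<theta> \<delta>(1) by auto
    have "b (\<theta> + \<delta>) - b \<theta> \<le> 2 * \<beta>" "b (\<theta> - \<delta>) - b \<theta> \<le> 2 * \<beta>"
      using \<beta>[of \<theta>] \<beta>[of "\<theta> + \<delta>"] \<beta>[of "\<theta> - \<delta>"] \<theta> \<delta>(1) by auto
    then have "(real p / \<delta>) ^ p * (exp (b (\<theta> + \<delta>) - b \<theta>) + exp (b (\<theta> - \<delta>) - b \<theta>)) \<le> K"
      unfolding K_def using \<delta>(1) by (intro mult_left_mono add_mono) auto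
    then show ?thesis
      using abs_moment_expfam[OF \<delta>(1) *, of p] by auto
  qed
  moreover have "0 \<le> K"
    using \<delta>(1) by (simp add: K_def)
  ultimately show ?thesis by blast
qed

end

section \<open>Existence and range of the least squares estimate\<close>

text \<open>Truncation at a level that bounds the data preserves the order and moves no coordinate
  in \<open>{1..n}\<close> away from the data. Minimization thus reduces to a compact set, which
  gives existence, and a minimizer exceeding \<open>B\<close> somewhere would be strictly improved
  by truncation.\<close>

lemma isotonic_lse_minimizes:
  fixes x :: "nat \<Rightarrow> real"
  assumes \<pi>: "\<pi> permutes {1..n}"
  shows "isotonic_lse n \<pi> x \<in> decreasing_along n \<pi>"
    and "m \<in> decreasing_along n \<pi> \<Longrightarrow>
      (\<Sum>i=1..n. (x i - isotonic_lse n \<pi> x i)\<^sup>2) \<le> (\<Sum>i=1..n. (x i - m i)\<^sup>2)"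
    and "i \<in> {1..n} \<Longrightarrow> (\<And>j. j \<in> {1..n} \<Longrightarrow> \<bar>x j\<bar> \<le> B) \<Longrightarrow> \<bar>isotonic_lse n \<pi> x i\<bar> \<le> B"
proof -
  define f where "f m = (\<Sum>i=1..n. (x i - m i)\<^sup>2)" for m
  \<comment> \<open>The value zero outside \<open>{1..n}\<close> places truncated vectors in a
    product of compact factors.\<close>
  define clip where "clip B m i = (if i \<in> {1..n} then max (- B) (min B (m i)) else 0)"
    for B :: real and m :: "nat \<Rightarrow> real" and i :: nat
  have \<pi>_mem: "\<pi> i \<in> {1..n} \<longleftrightarrow> i \<in> {1..n}" for i
    using permutes_in_image[OF \<pi>] .
  have clip_mem: "clip B m \<in> decreasing_along n \<pi>" if "m \<in> decreasing_along n \<pi>" for B m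
  proof -
    have "clip B m (\<pi> j) \<le> clip B m (\<pi> i)" if "i \<in> {1..n}" "j \<in> {1..n}" "i \<le> j" for i j
    proof -
      have "m (\<pi> j) \<le> m (\<pi> i)"
        using that \<open>m \<in> _\<close> by (simp add: decreasing_along_def)
      then show ?thesis
        using that \<pi>_mem[of i] \<pi>_mem[of j] by (auto simp: clip_def)
    qed
    then show ?thesis by (simp add: decreasing_along_def)
  qed
  have clip_le: "(x i - clip B m i)\<^sup>2 \<le> (x i - m i)\<^sup>2" if "\<bar>x i\<bar> \<le> B" "i \<in> {1..n}" for B m i
    using that by (subst abs_le_square_iff[symmetric]) (auto simp: clip_def)
  have clip_less: "(x i - clip B m i)\<^sup>2 < (x i - m i)\<^sup>2"
    if "\<bar>x i\<bar> \<le> B" "i \<in> {1..n}" "B < \<bar>m i\<bar>" for B m i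
    using that by (intro power2_strict_mono) (auto simp: clip_def)
  \<comment> \<open>A sum is used instead of a maximum because it also makes sense for
    \<open>n = 0\<close>.\<close>
  define A where "A = (\<Sum>i=1..n. \<bar>x i\<bar>)"
  have A: "\<bar>x i\<bar> \<le> A" if "i \<in> {1..n}" for i
    unfolding A_def using that by (intro member_le_sum) auto
  define C where "C = (PiE UNIV (\<lambda>i. if i \<in> {1..n} then {- A..A} else {0})) \<inter> decreasing_along n \<pi>"
  \<comment> \<open>Tychonoff's theorem in the product topology; the cone is closed, being cut out
    by inequalities between coordinates.\<close>
  have "compact (PiE UNIV (\<lambda>i::nat. if i \<in> {1..n} then {- A..A} else {0 :: real}))"
    unfolding compactin_euclidean_iff[symmetric] euclidean_product_topology[symmetric]
    by (subst compactin_PiE) auto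
  moreover have "closed (decreasing_along n \<pi>)"
    unfolding decreasing_along_def Ball_def
    by (intro closed_Collect_all closed_Collect_imp closed_Collect_le open_Collect_const) auto
  ultimately have "compact C"
    unfolding C_def by (rule compact_Int_closed)
  have clipC: "clip A m \<in> C" if "m \<in> decreasing_along n \<pi>" for m
  proof -
    have "A \<ge> 0" by (simp add: A_def sum_nonneg)
    then show ?thesis using clip_mem[OF that] by (auto simp: C_def clip_def)
  qed
  have "(\<lambda>_. 0) \<in> decreasing_along n \<pi>"
    by (simp add: decreasing_along_def)
  then have "C \<noteq> {}"
    using clipC by blast
  moreover have "continuous_on C f"
    unfolding f_def by (intro continuous_intros) (auto intro: continuous_on_subset[OF continuous_on_product_coordinates])
  ultimately obtain m0 where m0: "m0 \<in> C" "\<And>m. m \<in> C \<Longrightarrow> f m0 \<le> f m"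
    using continuous_attains_inf[OF \<open>compact C\<close>] by blast
  have "\<exists>m. is_arg_min f (\<lambda>m. m \<in> decreasing_along n \<pi>) m"
  proof (intro exI[of _ m0], unfold is_arg_min_linorder, intro conjI allI impI)
    show "m0 \<in> decreasing_along n \<pi>"
      using m0(1) by (simp add: C_def)
    fix m assume m: "m \<in> decreasing_along n \<pi>"
    have "f m0 \<le> f (clip A m)"
      using m clipC m0(2) by blast
    also have "\<dots> \<le> f m"
      unfolding f_def using A clip_le by (intro sum_mono) auto
    finally show "f m0 \<le> f m" .
  qed
  then have "is_arg_min f (\<lambda>m. m \<in> decreasing_along n \<pi>) (isotonic_lse n \<pi> x)"
    unfolding isotonic_lse_def arg_min_on_def arg_min_def f_def by (rule someI_ex)
  then have lse: "isotonic_lse n \<pi> x \<in> decreasing_along n \<pi>"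
    "\<And>m. m \<in> decreasing_along n \<pi> \<Longrightarrow> f (isotonic_lse n \<pi> x) \<le> f m"
    by (auto simp: is_arg_min_linorder)
  show "isotonic_lse n \<pi> x \<in> decreasing_along n \<pi>"
    by (rule lse)
  show "m \<in> decreasing_along n \<pi> \<Longrightarrow>
      (\<Sum>i=1..n. (x i - isotonic_lse n \<pi> x i)\<^sup>2) \<le> (\<Sum>i=1..n. (x i - m i)\<^sup>2)"
    using lse(2)[of m] by (simp add: f_def)
  show "\<bar>isotonic_lse n \<pi> x i\<bar> \<le> B"
    if i: "i \<in> {1..n}" and B: "\<And>j. j \<in> {1..n} \<Longrightarrow> \<bar>x j\<bar> \<le> B"
  proof (rule ccontr)
    assume "\<not> \<bar>isotonic_lse n \<pi> x i\<bar> \<le> B"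
    then have "f (clip B (isotonic_lse n \<pi> x)) < f (isotonic_lse n \<pi> x)"
      unfolding f_def using B i clip_le
      by (intro sum_strict_mono_ex1 bexI[of _ i] clip_less) auto
    then show False
      using lse(2)[OF clip_mem[OF lse(1)], of B] by simp
  qed
qed

section \<open>Deterministic bound on the squared error\<close>

text \<open>Summation by parts: the drops of \<open>m\<close> all have one sign, so they telescope
  to at most \<open>2 * B\<close> whatever \<open>n\<close> is, and the boundary term adds one more
  \<open>B\<close>.\<close>

lemma abel_bound_decreasing:
  fixes e m :: "nat \<Rightarrow> real"
  assumes n: "0 < n"
    and mono: "\<And>i j. 1 \<le> i \<Longrightarrow> i \<le> j \<Longrightarrow> j \<le> n \<Longrightarrow> m j \<le> m i"
    and m: "\<And>i. i \<in> {1..n} \<Longrightarrow> \<bar>m i\<bar> \<le> B"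
    and e: "\<And>k. k \<le> n \<Longrightarrow> \<bar>\<Sum>i=1..k. e i\<bar> \<le> s"
  shows "\<bar>\<Sum>i=1..n. e i * m i\<bar> \<le> 3 * B * s"
proof -
  \<comment> \<open>With the boundary term removed, what remains are partial sums of
    \<open>e\<close> times drops of \<open>m\<close>, and the drops up to \<open>k\<close> add up to
    \<open>m 1 - m k\<close>.\<close>
  have *: "\<bar>(\<Sum>i=1..k. e i * m i) - (\<Sum>i=1..k. e i) * m k\<bar> \<le> s * (m 1 - m k)"
    if "1 \<le> k" "k \<le> n" for k
    using that
  proof (induction k rule: dec_induct)
    case (step k)
    have "\<bar>(\<Sum>i=1..k. e i) * (m k - m (Suc k))\<bar> \<le> s * (m k - m (Suc k))"
      using step e[of k] mono[of k "Suc k"] by (auto simp: abs_mult intro!: mult_right_mono)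
    moreover have "(\<Sum>i=1..Suc k. e i * m i) - (\<Sum>i=1..Suc k. e i) * m (Suc k) =
        ((\<Sum>i=1..k. e i * m i) - (\<Sum>i=1..k. e i) * m k) + (\<Sum>i=1..k. e i) * (m k - m (Suc k))"
      by (simp add: algebra_simps)
    ultimately show ?case
      using step by (simp add: algebra_simps)
  qed simp
  have "0 \<le> s" using e[of 0] by simp
  have "m 1 - m n \<le> 2 * B"
    using m[of 1] m[of n] n by auto
  then have "s * (m 1 - m n) \<le> s * (2 * B)"
    using \<open>0 \<le> s\<close> by (rule mult_left_mono)
  moreover have "\<bar>(\<Sum>i=1..n. e i) * m n\<bar> \<le> s * B"
    unfolding abs_mult using e[of n] m[of n] n \<open>0 \<le> s\<close> by (intro mult_mono) auto
  ultimately show ?thesis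
    using *[of n] n by (simp add: algebra_simps)
qed

text \<open>Cut at the last multiple of \<open>L\<close> up to \<open>k\<close>. A maximum over all
  \<open>k\<close> then costs only a sum over block ends, and the fewer than \<open>L\<close>
  remaining terms are handled by Cauchy-Schwarz.\<close>

lemma partial_sum_block_bound:
  fixes e :: "nat \<Rightarrow> real"
  assumes "0 < L" "k \<le> n"
  shows "(\<Sum>i=1..k. e i)\<^sup>2 \<le>
    2 * (\<Sum>j\<le>n div L. (\<Sum>i=1..j * L. e i)\<^sup>2) + 2 * real L * (\<Sum>i=1..n. (e i)\<^sup>2)"
proof -
  define q where "q = k div L * L"
  define A where "A = (\<Sum>i=1..q. e i)"
  define R where "R = (\<Sum>i\<in>{q<..k}. e i)"
  have q: "q \<le> k" "k \<le> q + L"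
    using mod_less_divisor[OF assms(1), of k] div_mult_mod_eq[of k L] unfolding q_def by linarith+
  have *: "{1..k} = {1..q} \<union> {q<..k}"
    using q by auto
  have "(\<Sum>i=1..k. e i) = A + R"
    unfolding A_def R_def * by (rule sum.union_disjoint) auto
  then have "(\<Sum>i=1..k. e i)\<^sup>2 \<le> 2 * A\<^sup>2 + 2 * R\<^sup>2"
    using zero_le_power2[of "A - R"] by (simp add: power2_eq_square algebra_simps)
  \<comment> \<open>The index \<open>j = 0\<close> with its empty inner sum covers the case
    \<open>k < L\<close>.\<close>
  moreover have "A\<^sup>2 \<le> (\<Sum>j\<le>n div L. (\<Sum>i=1..j * L. e i)\<^sup>2)"
    unfolding A_def q_def using assms
    by (intro member_le_sum[where f = "\<lambda>j. (\<Sum>i=1..j * L. e i)\<^sup>2"]) (auto simp: div_le_mono)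
  moreover have "R\<^sup>2 \<le> real L * (\<Sum>i=1..n. (e i)\<^sup>2)"
  proof -
    have "R\<^sup>2 \<le> real (card {q<..k}) * (\<Sum>i\<in>{q<..k}. (e i)\<^sup>2)"
      using Cauchy_Schwarz_ineq_sum[of "\<lambda>_. 1" e "{q<..k}"] by (simp add: R_def)
    also have "\<dots> \<le> real L * (\<Sum>i=1..n. (e i)\<^sup>2)"
      using q assms by (intro mult_mono sum_mono2 sum_nonneg) auto
    finally show ?thesis .
  qed
  ultimately show ?thesis by (simp add: algebra_simps)
qed

text \<open>When \<open>x\<^sup>2\<close> exceeds \<open>t\<close>, the factor
  \<open>(x\<^sup>2 / t)\<^sup>2\<close> is above one. With growing \<open>t\<close> this bounds the
  largest observation through the sum of sixth powers; with \<open>t = 1\<close> it makes second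
  moments finite.\<close>

lemma square_le_add_sixth_power:
  fixes t x :: real
  assumes "0 < t"
  shows "x\<^sup>2 \<le> t + x ^ 6 / t\<^sup>2"
proof (cases "x\<^sup>2 \<le> t")
  case True
  then show ?thesis by (rule order.trans) simp
next
  case False
  then have "t\<^sup>2 * x\<^sup>2 \<le> (x\<^sup>2)\<^sup>2 * x\<^sup>2"
    using assms by (intro mult_right_mono power_mono) auto
  then have "x\<^sup>2 \<le> x ^ 6 / t\<^sup>2"
    using assms by (simp add: field_simps flip: power_mult power_add)
  then show ?thesis using assms by linarith
qed

text \<open>The parameter \<open>a\<close> comes from Young's inequality applied to \<open>(B + V) s\<close>, where \<open>B\<close> and \<open>s\<close> bound the
  data and the partial sums, and \<open>t\<close> from \<open>B\<^sup>2 \<le> t + B\<^sup>6 / t\<^sup>2\<close>.\<close>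

lemma isotonic_lse_error_bound:
  fixes x \<mu> :: "nat \<Rightarrow> real"
  assumes n: "0 < n" and \<pi>: "\<pi> permutes {1..n}" and \<mu>: "\<mu> \<in> decreasing_along n \<pi>"
    and V: "\<And>i. i \<in> {1..n} \<Longrightarrow> \<bar>\<mu> i\<bar> \<le> V"
    and pos: "0 < a" "0 < t" "0 < L"
  shows "(\<Sum>i=1..n. (isotonic_lse n \<pi> x i - \<mu> i)\<^sup>2) \<le>
    6 * a * (V\<^sup>2 + t + (\<Sum>i=1..n. x i ^ 6) / t\<^sup>2) +
    6 / a * ((\<Sum>j\<le>n div L. (\<Sum>i\<in>\<pi> ` {1..j * L}. x i - \<mu> i)\<^sup>2) + real L * (\<Sum>i=1..n. (x i - \<mu> i)\<^sup>2))"
proof -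
  define m where "m = isotonic_lse n \<pi> x"
  \<comment> \<open>Reading the noise in the order given by \<open>\<pi>\<close> turns vectors that
    decrease along \<open>\<pi>\<close> into ordinary decreasing sequences.\<close>
  define e where "e i = x (\<pi> i) - \<mu> (\<pi> i)" for i
  define B where "B = Max ((\<lambda>i. \<bar>x i\<bar>) ` {1..n})"
  have B: "\<bar>x i\<bar> \<le> B" if "i \<in> {1..n}" for i
    unfolding B_def using that by (intro Max_ge) auto
  have "B \<in> (\<lambda>i. \<bar>x i\<bar>) ` {1..n}"
    unfolding B_def using n by (intro Max_in) auto
  then obtain i0 where i0: "i0 \<in> {1..n}" "B = \<bar>x i0\<bar>"
    by blast
  have \<pi>_mem: "\<pi> i \<in> {1..n} \<longleftrightarrow> i \<in> {1..n}" for i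
    using permutes_in_image[OF \<pi>] .
  have inj: "inj_on \<pi> A" for A
    using permutes_inj_on[OF \<pi>] .
  define G where "G = (\<Sum>j\<le>n div L. (\<Sum>i=1..j * L. e i)\<^sup>2) + real L * (\<Sum>i=1..n. (e i)\<^sup>2)"
  have G: "G = (\<Sum>j\<le>n div L. (\<Sum>i\<in>\<pi> ` {1..j * L}. x i - \<mu> i)\<^sup>2) + real L * (\<Sum>i=1..n. (x i - \<mu> i)\<^sup>2)"
    unfolding G_def e_def using sum.permute[OF \<pi>, of "\<lambda>i. (x i - \<mu> i)\<^sup>2"]
    by (simp add: sum.reindex[OF inj] o_def)
  have "0 \<le> G"
    unfolding G_def by (intro add_nonneg_nonneg sum_nonneg mult_nonneg_nonneg) auto
  \<comment> \<open>\<open>2 * G\<close> is the right side of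
    \<open>partial_sum_block_bound\<close>, so \<open>s\<close> bounds all partial sums at
    once.\<close>
  define s where "s = sqrt (2 * G)"
  have s: "\<bar>\<Sum>i=1..k. e i\<bar> \<le> s" if "k \<le> n" for k
    using partial_sum_block_bound[OF pos(3) that, of e]
    unfolding s_def G_def by (intro real_le_rsqrt) (simp add: algebra_simps)
  have abel: "\<bar>\<Sum>i=1..n. e i * u (\<pi> i)\<bar> \<le> 3 * D * s"
    if "u \<in> decreasing_along n \<pi>" "\<And>i. i \<in> {1..n} \<Longrightarrow> \<bar>u i\<bar> \<le> D" for u D
    using that \<pi>_mem s by (intro abel_bound_decreasing n) (auto simp: decreasing_along_def)
  have 1: "\<bar>\<Sum>i=1..n. e i * m (\<pi> i)\<bar> \<le> 3 * B * s"
    unfolding m_def using isotonic_lse_minimizes(1,3)[OF \<pi>] B by (intro abel) blast+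
  have 2: "\<bar>\<Sum>i=1..n. e i * \<mu> (\<pi> i)\<bar> \<le> 3 * V * s"
    using \<mu> V by (rule abel)
  \<comment> \<open>Expansion of the square of \<open>x - m = (x - \<mu>) - (m - \<mu>)\<close>. The
    first two sums have nonpositive difference because \<open>\<mu>\<close> competes in the
    minimization.\<close>
  have "(\<Sum>i=1..n. (m i - \<mu> i)\<^sup>2) =
      (\<Sum>i=1..n. (x i - m i)\<^sup>2) - (\<Sum>i=1..n. (x i - \<mu> i)\<^sup>2) + 2 * (\<Sum>i=1..n. (x i - \<mu> i) * (m i - \<mu> i))"
    by (simp add: sum_distrib_left sum_subtractf[symmetric] sum.distrib[symmetric]
        power2_eq_square algebra_simps)
  also have "\<dots> \<le> 2 * (\<Sum>i=1..n. (x i - \<mu> i) * (m i - \<mu> i))"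
    using isotonic_lse_minimizes(2)[OF \<pi> \<mu>, of x] by (simp add: m_def)
  also have "(\<Sum>i=1..n. (x i - \<mu> i) * (m i - \<mu> i)) = (\<Sum>i=1..n. e i * (m (\<pi> i) - \<mu> (\<pi> i)))"
    using sum.permute[OF \<pi>, of "\<lambda>i. (x i - \<mu> i) * (m i - \<mu> i)"] by (simp add: o_def e_def)
  also have "\<dots> = (\<Sum>i=1..n. e i * m (\<pi> i)) - (\<Sum>i=1..n. e i * \<mu> (\<pi> i))"
    by (simp add: sum_subtractf algebra_simps)
  \<comment> \<open>The factor 6 is two from the expansion times three from summation by
    parts.\<close>
  also have "2 * \<dots> \<le> 6 * ((B + V) * s)"
    using 1 2 by (simp add: algebra_simps)
  also have "(B + V) * s \<le> (a * (B + V)\<^sup>2 + s\<^sup>2 / a) / 2"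
  proof -
    have "0 \<le> (a * (B + V) - s)\<^sup>2 / a" using pos by simp
    also have "\<dots> = a * (B + V)\<^sup>2 - 2 * ((B + V) * s) + s\<^sup>2 / a"
      using pos by (simp add: field_simps power2_eq_square)
    finally show ?thesis by simp
  qed
  also have "s\<^sup>2 = 2 * G"
    using \<open>0 \<le> G\<close> by (simp add: s_def)
  also have "(B + V)\<^sup>2 \<le> 2 * (V\<^sup>2 + t + (\<Sum>i=1..n. x i ^ 6) / t\<^sup>2)"
  proof -
    have "(B + V)\<^sup>2 \<le> 2 * (V\<^sup>2 + B\<^sup>2)"
      using zero_le_power2[of "B - V"] by (simp add: power2_eq_square algebra_simps)
    moreover have "B\<^sup>2 \<le> t + x i0 ^ 6 / t\<^sup>2"
      using square_le_add_sixth_power[OF pos(2), of "x i0"] i0 by simp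
    \<comment> \<open>The maximum \<open>B\<close> is attained at \<open>i0\<close>, so its sixth
      power is one term of the sum.\<close>
    moreover have "x i0 ^ 6 \<le> (\<Sum>i=1..n. x i ^ 6)"
      using i0 by (intro member_le_sum) auto
    then have "x i0 ^ 6 / t\<^sup>2 \<le> (\<Sum>i=1..n. x i ^ 6) / t\<^sup>2"
      by (simp add: divide_right_mono)
    ultimately show ?thesis by (simp add: algebra_simps)
  qed
  finally show ?thesis
    using pos by (simp add: m_def G field_simps)
qed

section \<open>Second moments of sums and the risk bound for fixed \<open>n\<close>\<close>

text \<open>Cross terms vanish: each added variable is centred and independent of the sum of the
  others.\<close>

lemma (in prob_space) second_moment_indep_sum:
  fixes Y :: "'i \<Rightarrow> 'a \<Rightarrow> real"
  assumes "finite I" "indep_vars (\<lambda>_. borel) Y I"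
    and "\<And>i. i \<in> I \<Longrightarrow> integrable M (\<lambda>\<omega>. (Y i \<omega>)\<^sup>2)"
    and "\<And>i. i \<in> I \<Longrightarrow> expectation (Y i) = 0"
  shows "has_bochner_integral M (\<lambda>\<omega>. (\<Sum>i\<in>I. Y i \<omega>)\<^sup>2) (\<Sum>i\<in>I. expectation (\<lambda>\<omega>. (Y i \<omega>)\<^sup>2))"
  using assms
proof (induction I)
  case empty
  then show ?case by (simp add: has_bochner_integral_zero)
next
  case (insert i I)
  have rv: "random_variable borel (Y j)" if "j \<in> insert i I" for j
    using insert.prems(1) that by (auto simp: indep_vars_def)
  have int: "integrable M (Y j)" if "j \<in> insert i I" for j
    using rv[OF that] insert.prems(2)[OF that] by (rule square_integrable_imp_integrable)
  have "indep_vars (\<lambda>_. borel) Y I"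
    using insert.prems(1) by (rule indep_vars_subset) auto
  then have IH: "has_bochner_integral M (\<lambda>\<omega>. (\<Sum>i\<in>I. Y i \<omega>)\<^sup>2) (\<Sum>i\<in>I. expectation (\<lambda>\<omega>. (Y i \<omega>)\<^sup>2))"
    using insert by blast
  have indep: "indep_var borel (Y i) borel (\<lambda>\<omega>. \<Sum>i\<in>I. Y i \<omega>)"
    using insert by (intro indep_vars_sum) auto
  have sum_int: "integrable M (\<lambda>\<omega>. \<Sum>i\<in>I. Y i \<omega>)"
    using int by (intro Bochner_Integration.integrable_sum) auto
  have "has_bochner_integral M (\<lambda>\<omega>. Y i \<omega> * (\<Sum>i\<in>I. Y i \<omega>)) 0"
    using indep_var_integrable[OF indep int sum_int] indep_var_lebesgue_integral[OF indep int sum_int]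
      insert.prems(3)[of i] by (simp add: has_bochner_integral_iff)
  then have "has_bochner_integral M
      (\<lambda>\<omega>. (Y i \<omega>)\<^sup>2 + (\<Sum>i\<in>I. Y i \<omega>)\<^sup>2 + 2 * (Y i \<omega> * (\<Sum>i\<in>I. Y i \<omega>)))
      (expectation (\<lambda>\<omega>. (Y i \<omega>)\<^sup>2) + (\<Sum>i\<in>I. expectation (\<lambda>\<omega>. (Y i \<omega>)\<^sup>2)) + 2 * 0)"
    using insert.prems(2)[of i] IH
    by (intro has_bochner_integral_add has_bochner_integral_mult_right has_bochner_integral_integrable) auto
  then show ?case
    using insert.hyps by (simp add: power2_sum algebra_simps)
qed

text \<open>Integrates \<open>isotonic_lse_error_bound\<close>. Each of the
  \<open>n div L + 1\<close> block sums has second moment at most the total variance, hence at most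
  \<open>n * (1 + K)\<close>; the within-block term contributes \<open>L\<close> times as
  much.\<close>

lemma (in prob_space) isotonic_lse_risk_bound:
  fixes X :: "nat \<Rightarrow> 'a \<Rightarrow> real"
  assumes n: "0 < n" and \<pi>: "\<pi> permutes {1..n}" and \<mu>: "\<mu> \<in> decreasing_along n \<pi>"
    and V: "\<And>i. i \<in> {1..n} \<Longrightarrow> \<bar>\<mu> i\<bar> \<le> V"
    and indep: "indep_vars (\<lambda>_. borel) X {1..n}"
    and mean: "\<And>i. i \<in> {1..n} \<Longrightarrow> expectation (X i) = \<mu> i"
    and int6: "\<And>i. i \<in> {1..n} \<Longrightarrow> integrable M (\<lambda>\<omega>. X i \<omega> ^ 6)"
    and K: "\<And>i. i \<in> {1..n} \<Longrightarrow> expectation (\<lambda>\<omega>. X i \<omega> ^ 6) \<le> K"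
    and pos: "0 < a" "0 < t" "0 < L"
  shows "(\<integral>\<^sup>+\<omega>. ennreal (\<Sum>i=1..n. (isotonic_lse n \<pi> (\<lambda>i. X i \<omega>) i - \<mu> i)\<^sup>2) \<partial>M) \<le>
    ennreal (6 * a * (V\<^sup>2 + t + real n * K / t\<^sup>2) +
      6 / a * ((real (n div L) + 1 + real L) * (real n * (1 + K))))"
proof -
  have rv[measurable]: "i \<in> {1..n} \<Longrightarrow> random_variable borel (X i)" for i
    using indep by (auto simp: indep_vars_def)
  have int2: "integrable M (\<lambda>\<omega>. (X i \<omega>)\<^sup>2)" if "i \<in> {1..n}" for i
  proof (rule Bochner_Integration.integrable_bound)
    show "integrable M (\<lambda>\<omega>. 1 + X i \<omega> ^ 6)"
      using int6[OF that] by simp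
    show "AE \<omega> in M. norm ((X i \<omega>)\<^sup>2) \<le> norm (1 + X i \<omega> ^ 6)"
      using square_le_add_sixth_power[of 1] by (auto intro!: AE_I2 order.trans[OF _ abs_ge_self])
  qed (use that in measurable)
  have int1: "integrable M (X i)" if "i \<in> {1..n}" for i
    using rv[OF that] int2[OF that] by (rule square_integrable_imp_integrable)
  define Y where "Y i \<omega> = X i \<omega> - \<mu> i" for i \<omega>
  have intY: "integrable M (\<lambda>\<omega>. (Y i \<omega>)\<^sup>2)" if "i \<in> {1..n}" for i
    unfolding Y_def power2_diff using int1[OF that] int2[OF that] by simp
  \<comment> \<open>The variance is at most the second moment, and
    \<open>x\<^sup>2 \<le> 1 + x ^ 6\<close>.\<close>
  have Y2: "expectation (\<lambda>\<omega>. (Y i \<omega>)\<^sup>2) \<le> 1 + K" if "i \<in> {1..n}" for i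
  proof -
    have "expectation (\<lambda>\<omega>. (Y i \<omega>)\<^sup>2) = expectation (\<lambda>\<omega>. (X i \<omega>)\<^sup>2) - (\<mu> i)\<^sup>2"
      using variance_eq[OF int1[OF that] int2[OF that]] mean[OF that] by (simp add: Y_def)
    also have "\<dots> \<le> expectation (\<lambda>\<omega>. (X i \<omega>)\<^sup>2)" by simp
    also have "\<dots> \<le> expectation (\<lambda>\<omega>. 1 + X i \<omega> ^ 6)"
      using int2[OF that] int6[OF that] square_le_add_sixth_power[of 1] by (intro integral_mono) auto
    also have "\<dots> \<le> 1 + K"
      using int6[OF that] K[OF that] by (simp add: prob_space)
    finally show ?thesis .
  qed
  have sumY: "(\<Sum>i=1..n. expectation (\<lambda>\<omega>. (Y i \<omega>)\<^sup>2)) \<le> real n * (1 + K)"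
    using sum_mono[OF Y2, of "{1..n}"] by simp
  have S: "integrable M (\<lambda>\<omega>. (\<Sum>i\<in>J. Y i \<omega>)\<^sup>2)"
    "expectation (\<lambda>\<omega>. (\<Sum>i\<in>J. Y i \<omega>)\<^sup>2) \<le> real n * (1 + K)" if J: "J \<subseteq> {1..n}" for J
  proof -
    have "indep_vars (\<lambda>_. borel) Y J"
      unfolding Y_def by (rule indep_vars_compose2[OF indep_vars_subset[OF indep J]]) simp
    moreover have "expectation (Y i) = 0" if "i \<in> {1..n}" for i
      unfolding Y_def using int1[OF that] mean[OF that] by (simp add: prob_space)
    ultimately have *: "has_bochner_integral M (\<lambda>\<omega>. (\<Sum>i\<in>J. Y i \<omega>)\<^sup>2)
        (\<Sum>i\<in>J. expectation (\<lambda>\<omega>. (Y i \<omega>)\<^sup>2))"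
      using J intY by (intro second_moment_indep_sum) (auto intro: finite_subset)
    then show "integrable M (\<lambda>\<omega>. (\<Sum>i\<in>J. Y i \<omega>)\<^sup>2)"
      by (simp add: has_bochner_integral_iff)
    have "(\<Sum>i\<in>J. expectation (\<lambda>\<omega>. (Y i \<omega>)\<^sup>2)) \<le> (\<Sum>i=1..n. expectation (\<lambda>\<omega>. (Y i \<omega>)\<^sup>2))"
      using J by (intro sum_mono2) auto
    then show "expectation (\<lambda>\<omega>. (\<Sum>i\<in>J. Y i \<omega>)\<^sup>2) \<le> real n * (1 + K)"
      using * sumY by (simp add: has_bochner_integral_iff)
  qed
  have J: "\<pi> ` {1..j * L} \<subseteq> {1..n}" if "j \<le> n div L" for j
  proof -
    have "j * L \<le> n"
      using that pos(3) by (simp add: less_eq_div_iff_mult_less_eq)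
    then have "\<pi> ` {1..j * L} \<subseteq> \<pi> ` {1..n}"
      by (intro image_mono) auto
    then show ?thesis
      using permutes_image[OF \<pi>] by simp
  qed
  define T6 where "T6 \<omega> = (\<Sum>i=1..n. X i \<omega> ^ 6)" for \<omega>
  define TS where "TS \<omega> = (\<Sum>j\<le>n div L. (\<Sum>i\<in>\<pi> ` {1..j * L}. Y i \<omega>)\<^sup>2)" for \<omega>
  define TY where "TY \<omega> = (\<Sum>i=1..n. (Y i \<omega>)\<^sup>2)" for \<omega>
  have int[simp]: "integrable M T6" "integrable M TS" "integrable M TY"
    unfolding T6_def TS_def TY_def using int6 S(1)[OF J] intY
    by (auto intro!: Bochner_Integration.integrable_sum)
  have "expectation T6 = (\<Sum>i=1..n. expectation (\<lambda>\<omega>. X i \<omega> ^ 6))"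
    unfolding T6_def using int6 by (intro Bochner_Integration.integral_sum) auto
  then have T6: "expectation T6 \<le> real n * K"
    using sum_mono[OF K, of "{1..n}"] by simp
  have "expectation TS = (\<Sum>j\<le>n div L. expectation (\<lambda>\<omega>. (\<Sum>i\<in>\<pi> ` {1..j * L}. Y i \<omega>)\<^sup>2))"
    unfolding TS_def using S(1)[OF J] by (intro Bochner_Integration.integral_sum) auto
  also have "\<dots> \<le> (\<Sum>j\<le>n div L. real n * (1 + K))"
    using S(2)[OF J] by (intro sum_mono) auto
  finally have TS: "expectation TS \<le> (real (n div L) + 1) * (real n * (1 + K))"
    by (simp add: add.commute)
  have "expectation TY = (\<Sum>i=1..n. expectation (\<lambda>\<omega>. (Y i \<omega>)\<^sup>2))"
    unfolding TY_def using intY by (intro Bochner_Integration.integral_sum) auto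
  then have TY: "real L * expectation TY \<le> real L * (real n * (1 + K))"
    using sumY by (intro mult_left_mono) auto
  define H where "H \<omega> = 6 * a * (V\<^sup>2 + t + T6 \<omega> / t\<^sup>2) + 6 / a * (TS \<omega> + real L * TY \<omega>)" for \<omega>
  have le_H: "(\<Sum>i=1..n. (isotonic_lse n \<pi> (\<lambda>i. X i \<omega>) i - \<mu> i)\<^sup>2) \<le> H \<omega>" for \<omega>
    unfolding H_def T6_def TS_def TY_def Y_def using isotonic_lse_error_bound[OF n \<pi> \<mu> V pos] .
  \<comment> \<open>Monotonicity of the nonnegative integral holds for arbitrary integrands, so
    measurability of the estimate is not at issue; only \<open>H\<close> has to be
    integrable.\<close>
  have "(\<integral>\<^sup>+\<omega>. ennreal (\<Sum>i=1..n. (isotonic_lse n \<pi> (\<lambda>i. X i \<omega>) i - \<mu> i)\<^sup>2) \<partial>M) \<le>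
      (\<integral>\<^sup>+\<omega>. ennreal (H \<omega>) \<partial>M)"
    using le_H by (intro nn_integral_mono ennreal_leI) auto
  also have "\<dots> = ennreal (expectation H)"
  proof (rule nn_integral_eq_integral)
    show "integrable M H"
      unfolding H_def by simp
    have "0 \<le> H \<omega>" for \<omega>
      using le_H[of \<omega>] by (rule order.trans[rotated]) (simp add: sum_nonneg)
    then show "AE \<omega> in M. 0 \<le> H \<omega>" by simp
  qed
  also have "expectation H = 6 * a * (V\<^sup>2 + t + expectation T6 / t\<^sup>2) +
      6 / a * (expectation TS + real L * expectation TY)"
    unfolding H_def by (simp add: prob_space)
  also have "\<dots> \<le> 6 * a * (V\<^sup>2 + t + real n * K / t\<^sup>2) +
      6 / a * ((real (n div L) + 1) * (real n * (1 + K)) + real L * (real n * (1 + K)))"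
    using T6 TS TY pos by (intro add_mono mult_left_mono divide_right_mono) auto
  also have "\<dots> = 6 * a * (V\<^sup>2 + t + real n * K / t\<^sup>2) +
      6 / a * ((real (n div L) + 1 + real L) * (real n * (1 + K)))"
    by (simp add: algebra_simps)
  finally show ?thesis
    by (simp add: ennreal_leI)
qed

section \<open>Choice of the rates and passage to the limit\<close>

theorem proposition3:
  fixes \<rho> :: "real measure" and c b :: "real \<Rightarrow> real" and \<Theta> :: "real set"
    and V\<^sub>m\<^sub>i\<^sub>n V\<^sub>m\<^sub>a\<^sub>x :: real
    and \<mu> :: "nat \<Rightarrow> nat \<Rightarrow> real"
    and M :: "nat \<Rightarrow> 'a measure"
    and X :: "nat \<Rightarrow> nat \<Rightarrow> 'a \<Rightarrow> real"
    and \<pi> :: "nat \<Rightarrow> nat \<Rightarrow> nat"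
  assumes "regular_exponential_family \<rho> c \<Theta> b"
    and "V\<^sub>m\<^sub>i\<^sub>n < V\<^sub>m\<^sub>a\<^sub>x" and "V\<^sub>m\<^sub>i\<^sub>n \<in> deriv b ` \<Theta>" and "V\<^sub>m\<^sub>a\<^sub>x \<in> deriv b ` \<Theta>"
    and "\<And>n i. \<lbrakk>2 \<le> n; i \<in> {1..n}\<rbrakk> \<Longrightarrow> V\<^sub>m\<^sub>i\<^sub>n \<le> \<mu> n i \<and> \<mu> n i \<le> V\<^sub>m\<^sub>a\<^sub>x"
    and "\<And>n. 2 \<le> n \<Longrightarrow> prob_space (M n)"
    and "\<And>n. 2 \<le> n \<Longrightarrow> prob_space.indep_vars (M n) (\<lambda>_. borel) (X n) {1..n}"
    and "\<And>n i. \<lbrakk>2 \<le> n; i \<in> {1..n}\<rbrakk> \<Longrightarrow>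
           distr (M n) borel (X n i) = expfam \<rho> c b (the_inv_into \<Theta> (deriv b) (\<mu> n i))"
    and "\<And>n. 2 \<le> n \<Longrightarrow> \<pi> n permutes {1..n}"
    and "\<And>n. 2 \<le> n \<Longrightarrow> \<mu> n \<in> decreasing_along n (\<pi> n)"
  shows "limsup (\<lambda>n. ennreal (1 / real n) *
           (\<integral>\<^sup>+ \<omega>. ennreal (\<Sum>i=1..n. (isotonic_lse n (\<pi> n) (\<lambda>i. X n i \<omega>) i - \<mu> n i)\<^sup>2) \<partial>M n)) = 0"
proof -
  interpret regular_exponential_family \<rho> c \<Theta> b by fact
  obtain lo hi where lohi: "lo \<in> \<Theta>" "hi \<in> \<Theta>" "V\<^sub>m\<^sub>i\<^sub>n = deriv b lo" "V\<^sub>m\<^sub>a\<^sub>x = deriv b hi"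
    using assms(3,4) by blast
  obtain K where K: "0 \<le> K" "\<And>\<theta>. \<theta> \<in> {lo..hi} \<Longrightarrow> integrable (expfam \<rho> c b \<theta>) (\<lambda>x. x ^ 6)"
    "\<And>\<theta>. \<theta> \<in> {lo..hi} \<Longrightarrow> (\<integral>x. x ^ 6 \<partial>expfam \<rho> c b \<theta>) \<le> K"
    using uniform_abs_moment_bound[OF lohi(1,2), of 6] by (auto simp: power_even_abs)
  define V where "V = max \<bar>V\<^sub>m\<^sub>i\<^sub>n\<bar> \<bar>V\<^sub>m\<^sub>a\<^sub>x\<bar>"
  let ?R = "\<lambda>n. \<integral>\<^sup>+ \<omega>. ennreal (\<Sum>i=1..n. (isotonic_lse n (\<pi> n) (\<lambda>i. X n i \<omega>) i - \<mu> n i)\<^sup>2) \<partial>M n"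
  \<comment> \<open>The choice \<open>t = n powr (1/3)\<close> balances \<open>t\<close> against
    \<open>n / t\<^sup>2\<close>. Then \<open>a = n powr (7/12)\<close> balances
    \<open>a * t\<close> against \<open>n powr (3/2) / a\<close>: both are
    \<open>n powr (11/12)\<close>, so \<open>g n\<close> decays like
    \<open>n powr (-1/12)\<close>.\<close>
  define g where "g n = 1 / real n *
      (6 * real n powr (7/12) * (V\<^sup>2 + real n powr (1/3) + real n * K / (real n powr (1/3))\<^sup>2) +
       6 / real n powr (7/12) * ((2 * sqrt (real n) + 2) * (real n * (1 + K))))" for n
  have bound: "ennreal (1 / real n) * ?R n \<le> ennreal (g n)" if n: "2 \<le> n" for n
  proof -
    interpret prob_space "M n" using n by (rule assms(6))
    have rv: "X n i \<in> borel_measurable (M n)" if "i \<in> {1..n}" for i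
      using assms(7)[OF n] that by (auto simp: indep_vars_def)
    define \<theta> where "\<theta> i = the_inv_into \<Theta> (deriv b) (\<mu> n i)" for i
    have \<theta>: "\<theta> i \<in> {lo..hi}" "\<theta> i \<in> \<Theta>" "deriv b (\<theta> i) = \<mu> n i" if "i \<in> {1..n}" for i
      using the_inv_into_deriv_b[OF lohi(1,2), of "\<mu> n i"] assms(5)[OF n that] lohi(3,4)
      by (simp_all add: \<theta>_def)
    have law: "distr (M n) borel (X n i) = expfam \<rho> c b (\<theta> i)" if "i \<in> {1..n}" for i
      using assms(8)[OF n that] by (simp add: \<theta>_def)
    \<comment> \<open>This length balances the number of blocks against the block length; each is at
      most \<open>sqrt n + 1\<close>.\<close>
    define L where "L = nat \<lceil>sqrt (real n)\<rceil>"
    have sqrt_pos: "0 < sqrt (real n)" using n by simp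
    have L: "sqrt (real n) \<le> real L" "real L \<le> sqrt (real n) + 1" "0 < L"
      unfolding L_def using sqrt_pos by linarith+
    have "real (n div L) \<le> real n / real L"
      by (rule of_nat_div_le_of_nat)
    also have "\<dots> \<le> real n / sqrt (real n)"
      using L(1) sqrt_pos by (intro divide_left_mono mult_pos_pos) linarith+
    also have "\<dots> = sqrt (real n)"
      by (simp add: real_div_sqrt)
    finally have blocks: "real (n div L) + 1 + real L \<le> 2 * sqrt (real n) + 2"
      using L by linarith
    have "?R n \<le> ennreal (6 * real n powr (7/12) *
          (V\<^sup>2 + real n powr (1/3) + real n * K / (real n powr (1/3))\<^sup>2) +
        6 / real n powr (7/12) * ((real (n div L) + 1 + real L) * (real n * (1 + K))))"
    proof (rule isotonic_lse_risk_bound)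
      fix i assume i: "i \<in> {1..n}"
      show "\<bar>\<mu> n i\<bar> \<le> V"
        using assms(5)[OF n i] by (auto simp: V_def)
      show "expectation (X n i) = \<mu> n i"
        using mean_expfam[OF \<theta>(2)[OF i]] \<theta>(3)[OF i] integral_distr[OF rv[OF i], of "\<lambda>x. x"]
        by (simp add: has_bochner_integral_iff law[OF i])
      show "integrable (M n) (\<lambda>\<omega>. X n i \<omega> ^ 6)"
        using K(2)[OF \<theta>(1)[OF i]] integrable_distr[OF rv[OF i], of "\<lambda>x. x ^ 6"] by (simp add: law[OF i])
      show "expectation (\<lambda>\<omega>. X n i \<omega> ^ 6) \<le> K"
        using K(3)[OF \<theta>(1)[OF i]] integral_distr[OF rv[OF i], of "\<lambda>x. x ^ 6"] by (simp add: law[OF i])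
    qed (use n L assms(7,9,10) in auto)
    also have "\<dots> \<le> ennreal (6 * real n powr (7/12) *
          (V\<^sup>2 + real n powr (1/3) + real n * K / (real n powr (1/3))\<^sup>2) +
        6 / real n powr (7/12) * ((2 * sqrt (real n) + 2) * (real n * (1 + K))))"
      using blocks K(1) by (intro ennreal_leI add_left_mono mult_left_mono mult_right_mono) auto
    finally have "ennreal (1 / real n) * ?R n \<le> ennreal (1 / real n) * \<dots>"
      by (rule mult_left_mono) simp
    also have "\<dots> = ennreal (g n)"
      unfolding g_def by (rule ennreal_mult'[symmetric]) simp
    finally show ?thesis .
  qed
  have "g \<longlonglongrightarrow> 0"
    unfolding g_def by real_asymp
  then have upper: "(\<lambda>n. ennreal (g n)) \<longlonglongrightarrow> 0"
    unfolding ennreal_0[symmetric] by (rule tendsto_ennrealI)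
  \<comment> \<open>The model is specified only from \<open>n = 2\<close> on, so the domination is
    an eventual one.\<close>
  have le: "\<forall>\<^sub>F n in sequentially. ennreal (1 / real n) * ?R n \<le> ennreal (g n)"
    using eventually_ge_at_top[of 2] by eventually_elim (rule bound)
  have nonneg: "\<forall>\<^sub>F n in sequentially. 0 \<le> ennreal (1 / real n) * ?R n"
    by (intro always_eventually allI zero_le)
  have "(\<lambda>n. ennreal (1 / real n) * ?R n) \<longlonglongrightarrow> 0"
    by (rule tendsto_sandwich[OF nonneg le tendsto_const upper])
  then show ?thesis
    by (rule lim_imp_Limsup[rotated]) (rule sequentially_bot)
qed

end
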